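(* Let $\mathcal{F}$ be a class of graphs and let $\widetilde{\mathcal{F}}$ be the class of all subgraphs of graphs in $\mathcal{F}$. The following statements are equivalent: (i) the supremum of $\omega(\Sigma)$ over all $G\in\mathcal{F}$ and all neighborhood systems $\Sigma$ for $G$ with $\rho(\Sigma)=2$ is finite; (ii) there is a constant $C_\mathcal{F}$ such that every $G\in\mathcal{F}$ and every neighborhood system $\Sigma$ for $G$ satisfy $\omega(\Sigma)\le C_\mathcal{F}\cdot\rho(\Sigma)$; (iii) there is a function $f_\mathcal{F}$ such that every $G\in\mathcal{F}$ and every neighborhood system $\Sigma$ for $G$ satisfy $\omega(\Sigma)\le f_\mathcal{F}(\rho(\Sigma))$; (iv) there is an integer $n$ such that $\widetilde{\mathcal{F}}$ contains no $1$-subdivision of the complete graph $K_m$ for any $m\ge n$.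
   Context: Graphs are finite and simple. For a graph $G=(V,E)$, a neighborhood system for $G$ is a collection $(\Sigma(v))_{v\in V}$ with $\Sigma(v)\subseteq N(v)$ (the set of neighbors of $v$), and $\rho(\Sigma)=\max_v|\Sigma(v)|$. A $\Sigma$-clique is a set $C\subseteq V$ such that for every pair of distinct $u,v\in C$ there is $w\in V$ with $u,v\in\Sigma(w)$; $\omega(\Sigma)$ is the maximum size of a $\Sigma$-clique. The $1$-subdivision of a graph is obtained by subdividing each edge exactly once.
   Formalization: In (ii) the bound is required only for neighborhood systems with ρ(Σ) > 0, since on a nonempty graph the system with all Σ(v) empty has ρ(Σ) = 0 but ω(Σ) = 1, which would make (ii) fail for example for F = {K_1}. *)

theory Defs
  imports "Graph_Theory.Graph_Theory" "HOL-Library.Extended_Nat"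
begin

text \<open>
  Finite simple graphs are the library's pair graphs, in which an undirected edge is a pair of
  opposite arcs.
\<close>

definition neighbors :: "'a pair_pre_digraph \<Rightarrow> 'a \<Rightarrow> 'a set" where
  "neighbors G v = {u. v \<rightarrow>\<^bsub>with_proj G\<^esub> u}"

text \<open>
  A neighborhood system is a family indexed by the vertices of the graph. It is represented by a
  total function, and none of the notions below depends on its values outside the vertex set.
\<close>

definition neighborhood_system :: "'a pair_pre_digraph \<Rightarrow> ('a \<Rightarrow> 'a set) \<Rightarrow> bool" where
  "neighborhood_system G \<Sigma> \<longleftrightarrow> (\<forall>v\<in>pverts G. \<Sigma> v \<subseteq> neighbors G v)"

text \<open>
  On the natural numbers, the supremum of a finite set is its maximum, and 0 for the empty set
  (here: the graph without vertices).

  If all the sets \<open>\<Sigma> v\<close> are empty, then \<open>rho G \<Sigma> = 0\<close>, whereas \<open>omega G \<Sigma>\<close> below is still 1 when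
  \<open>G\<close> has a vertex, since singletons are cliques. A bound on \<open>omega\<close> that is linear in \<open>rho\<close> is
  therefore only meaningful for \<open>rho G \<Sigma> > 0\<close>.
\<close>

definition rho :: "'a pair_pre_digraph \<Rightarrow> ('a \<Rightarrow> 'a set) \<Rightarrow> nat" where
  "rho G \<Sigma> = (SUP v\<in>pverts G. card (\<Sigma> v))"

definition sigma_clique :: "'a pair_pre_digraph \<Rightarrow> ('a \<Rightarrow> 'a set) \<Rightarrow> 'a set \<Rightarrow> bool" where
  "sigma_clique G \<Sigma> C \<longleftrightarrow> C \<subseteq> pverts G \<and>
     (\<forall>u\<in>C. \<forall>v\<in>C. u \<noteq> v \<longrightarrow> (\<exists>w\<in>pverts G. u \<in> \<Sigma> w \<and> v \<in> \<Sigma> w))"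

definition omega :: "'a pair_pre_digraph \<Rightarrow> ('a \<Rightarrow> 'a set) \<Rightarrow> nat" where
  "omega G \<Sigma> = Max {card C | C. sigma_clique G \<Sigma> C}"

definition subgraph_closure :: "'a pair_pre_digraph set \<Rightarrow> 'a pair_pre_digraph set" where
  "subgraph_closure \<F> =
     {H. pair_graph H \<and> (\<exists>G\<in>\<F>. subgraph (with_proj H) (with_proj G))}"

text \<open>
  The vertex \<open>Inr {u, v}\<close> subdivides the edge joining \<open>u\<close> and \<open>v\<close>. As arcs come in opposite pairs,
  it is adjacent to both \<open>Inl u\<close> and \<open>Inl v\<close>.
\<close>

definition one_subdivision :: "'a pair_pre_digraph \<Rightarrow> ('a + 'a set) pair_pre_digraph" where
  "one_subdivision G =
     \<lparr> pverts = Inl ` pverts G \<union> {Inr {u, v} | u v. (u, v) \<in> parcs G},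
       parcs = {(Inl u, Inr {u, v}) | u v. (u, v) \<in> parcs G}
             \<union> {(Inr {u, v}, Inl u) | u v. (u, v) \<in> parcs G} \<rparr>"

definition is_one_subdivision_of_complete :: "nat \<Rightarrow> 'a pair_pre_digraph \<Rightarrow> bool" where
  "is_one_subdivision_of_complete m H \<longleftrightarrow>
     (\<exists>K :: nat pair_pre_digraph. K\<^bsub>m\<^esub> (with_proj K) \<and>
        digraph_iso (with_proj (one_subdivision K)) (with_proj H))"

end

theory Submission
  imports Defs
begin

text \<open>
  The cycle of implications is (iv), (ii), (iii), (i), (iv); only the first one has content. Let \<open>C\<close>
  be a largest clique of a neighborhood system with \<open>rho = r > 0\<close>, and let \<open>w e\<close> be a vertex whose
  set contains the pair \<open>e\<close> of elements of \<open>C\<close>. If \<open>w\<close> is injective on the pairs of some \<open>S \<subseteq> C\<close> and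
  takes no value in \<open>S\<close>, then the vertices \<open>w e\<close> subdivide a complete graph on \<open>S\<close>. Such an \<open>S\<close> is
  built greedily, along with a set \<open>X\<close> of vertices each of which can extend \<open>S\<close>. By double counting,
  some \<open>a \<in> X\<close> is in conflict with few \<open>x \<in> X\<close>. Adding \<open>a\<close> to \<open>S\<close> costs \<open>O(n\<^sup>2 r)\<close> elements of \<open>X\<close>,
  so \<open>card S = n\<close> is reached as soon as \<open>card C\<close> exceeds a constant multiple of \<open>n\<^sup>3 r\<close>.
\<close>

section \<open>Pairs and conflict-free vertex sets\<close>

definition pairs :: "'a set \<Rightarrow> 'a set set" where
  "pairs S = {{u, v} | u v. u \<in> S \<and> v \<in> S \<and> u \<noteq> v}"

text \<open>\<open>w e\<close> is the intended subdividing vertex of the pair \<open>e\<close>. The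
  condition makes these vertices distinct from each other and from the branch vertices
  \<open>S\<close>; adjacency is required separately.\<close>

definition subdividing :: "('a set \<Rightarrow> 'a) \<Rightarrow> 'a set \<Rightarrow> bool" where
  "subdividing w S \<longleftrightarrow> inj_on w (pairs S) \<and> w ` pairs S \<inter> S = {}"

lemma pairs_insert: "pairs (insert x S) = pairs S \<union> {{x, b} | b. b \<in> S \<and> b \<noteq> x}"
  unfolding pairs_def by (auto simp: insert_commute)

lemma pairs_mono: "S \<subseteq> T \<Longrightarrow> pairs S \<subseteq> pairs T"
  unfolding pairs_def by blast

lemma subdividing_mono: "subdividing w T \<Longrightarrow> S \<subseteq> T \<Longrightarrow> subdividing w S"
  unfolding subdividing_def using pairs_mono[of S T] by (blast intro: inj_on_subset)

lemma finite_pairs: "finite S \<Longrightarrow> finite (pairs S)"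
  by (rule finite_subset[of _ "Pow S"]) (auto simp: pairs_def)

lemma card_pairs_le:
  assumes "finite S"
  shows "card (pairs S) \<le> (card S)\<^sup>2"
proof -
  have "pairs S \<subseteq> (\<lambda>(u, v). {u, v}) ` (S \<times> S)"
    unfolding pairs_def by auto
  then have "card (pairs S) \<le> card (S \<times> S)"
    using assms by (meson card_image_le card_mono finite_SigmaI finite_imageI le_trans)
  then show ?thesis by (simp add: card_cartesian_product power2_eq_square)
qed

text \<open>Double counting: if every \<open>a\<close> had more than \<open>d\<close> related
  \<open>x\<close>, the number of related pairs would exceed \<open>d * card X\<close>, but counted
  by \<open>x\<close> it is at most that.\<close>

lemma exists_small_fibre:
  fixes R :: "'a \<Rightarrow> 'a \<Rightarrow> bool"
  assumes "finite X" "X \<noteq> {}" and "\<And>x. x \<in> X \<Longrightarrow> card {a \<in> X. R a x} \<le> d"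
  shows "\<exists>a\<in>X. card {x \<in> X. R a x} \<le> d"
proof (rule ccontr)
  assume "\<not> ?thesis"
  then have "(\<Sum>a\<in>X. d) < (\<Sum>a\<in>X. card {x \<in> X. R a x})"
    using assms by (intro sum_strict_mono) auto
  also have "\<dots> = (\<Sum>x\<in>X. card {a \<in> X. R a x})"
    using assms by (intro sum_multicount_gen) auto
  also have "\<dots> \<le> (\<Sum>x\<in>X. d)"
    using assms by (intro sum_mono)
  finally show False by simp
qed

lemma card_UN_le_mult:
  assumes "finite I" "card I \<le> n" "\<And>i. i \<in> I \<Longrightarrow> card (A i) \<le> r"
  shows "card (\<Union>i\<in>I. A i) \<le> n * r"
proof -
  have "card (\<Union>i\<in>I. A i) \<le> (\<Sum>i\<in>I. card (A i))"
    by (rule card_UN_le) fact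
  also have "\<dots> \<le> card I * r"
    using sum_bounded_above[of I "\<lambda>i. card (A i)" r] assms by simp
  also have "\<dots> \<le> n * r" using assms by simp
  finally show ?thesis .
qed

section \<open>Greedy construction of a conflict-free set\<close>

text \<open>
  \<open>B c\<close> stands for the closed set \<open>{c} \<union> \<Sigma> c\<close>. Any coincidence between \<open>w {x, a}\<close> and \<open>w {x, b}\<close>, as
  well as \<open>w {x, b} = a\<close>, puts \<open>a\<close> into \<open>B (w {x, b})\<close>; all other new coincidences put \<open>x\<close> into \<open>B c\<close>
  for a vertex \<open>c\<close> that is already in use.
\<close>

lemma subdividing_insert_insert:
  assumes ax: "a \<noteq> x" "a \<notin> S" "x \<notin> S"
    and self: "\<And>c. c \<in> B c"
    and cover: "\<And>u v. u \<in> insert x (insert a S) \<Longrightarrow> v \<in> insert x (insert a S) \<Longrightarrow> u \<noteq> v \<Longrightarrow>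
                 u \<in> B (w {u, v}) \<and> w {u, v} \<noteq> u"
    and sa: "subdividing w (insert a S)" and sx: "subdividing w (insert x S)"
    and bad: "\<And>b. b \<in> S \<Longrightarrow> a \<notin> B (w {x, b})"
    and out: "\<And>c. c \<in> insert a S \<union> w ` pairs (insert a S) \<Longrightarrow> x \<notin> B c"
  shows "subdividing w (insert x (insert a S))"
proof -
  let ?T = "insert a S"
  have cover': "v \<in> B (w {u, v}) \<and> w {u, v} \<noteq> v"
    if "u \<in> insert x ?T" "v \<in> insert x ?T" "u \<noteq> v" for u v
    using cover[of v u] that by (simp add: insert_commute)
  have star_new: "w {x, b} \<notin> w ` pairs ?T" if "b \<in> ?T" for b
    using out[of "w {x, b}"] cover[of x b] that ax by auto
  have sxS: "w {x, b} = w {x, b'} \<longrightarrow> {x, b} = {x, b'}" "w {x, b} \<notin> insert x S"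
    if "b \<in> S" "b' \<in> S" for b b'
  proof -
    have "{x, b} \<in> pairs (insert x S)" "{x, b'} \<in> pairs (insert x S)"
      using that ax by (auto simp: pairs_insert)
    then show "w {x, b} = w {x, b'} \<longrightarrow> {x, b} = {x, b'}" "w {x, b} \<notin> insert x S"
      using sx unfolding subdividing_def by (blast dest: inj_onD)+
  qed
  have star_a: "w {x, a} \<noteq> w {x, b}" if "b \<in> S" for b
    using bad[OF that] cover'[of x a] ax by auto
  have inj_star: "{x, b} = {x, b'}" if "b \<in> ?T" "b' \<in> ?T" "w {x, b} = w {x, b'}" for b b'
    using that star_a sxS(1) by (metis insertE)
  have star_out: "w {x, b} \<notin> insert x ?T" if "b \<in> ?T" for b
  proof (cases "b = a")
    case True
    have "w {x, a} \<noteq> c" if "c \<in> S" for c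
      using out[of c] cover[of x a] that ax by auto
    then show ?thesis using True cover[of x a] cover'[of x a] ax by auto
  next
    case False
    then show ?thesis using that sxS(2)[of b b] bad[of b] self[of a] by auto
  qed
  \<comment> \<open>By \<open>self\<close>, the equality \<open>w e = x\<close> would put
    \<open>x\<close> into \<open>B (w e)\<close>, which \<open>out\<close> forbids; this is one
    reason for working with closed sets.\<close>
  have old_out: "w e \<notin> insert x ?T" if "e \<in> pairs ?T" for e
    using that sa out[of "w e"] self[of x] unfolding subdividing_def by auto
  have split: "g \<in> pairs ?T \<or> (\<exists>b\<in>?T. g = {x, b})" if "g \<in> pairs (insert x ?T)" for g
    using that unfolding pairs_insert[of x ?T] by blast
  have "inj_on w (pairs (insert x ?T))"
  proof (rule inj_onI)
    fix e f assume ef: "e \<in> pairs (insert x ?T)" "f \<in> pairs (insert x ?T)" "w e = w f"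
    have sa': "inj_on w (pairs ?T)" using sa unfolding subdividing_def by blast
    from split[OF ef(1)] split[OF ef(2)] show "e = f"
    proof (elim disjE bexE)
      assume "e \<in> pairs ?T" "f \<in> pairs ?T"
      then show ?thesis using sa' ef(3) by (auto dest: inj_onD)
    next
      fix b assume "e \<in> pairs ?T" "b \<in> ?T" "f = {x, b}"
      then show ?thesis using star_new[of b] ef(3) by (metis image_eqI)
    next
      fix b assume "f \<in> pairs ?T" "b \<in> ?T" "e = {x, b}"
      then show ?thesis using star_new[of b] ef(3) by (metis image_eqI)
    next
      fix b c assume "b \<in> ?T" "c \<in> ?T" "e = {x, b}" "f = {x, c}"
      then show ?thesis using inj_star[of b c] ef(3) by simp
    qed
  qed
  moreover have "w ` pairs (insert x ?T) \<inter> insert x ?T = {}"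
  proof -
    have "w g \<notin> insert x ?T" if "g \<in> pairs (insert x ?T)" for g
      using split[OF that] star_out old_out by (elim disjE bexE) simp_all
    then show ?thesis by blast
  qed
  ultimately show ?thesis unfolding subdividing_def by blast
qed

text \<open>Every single \<open>x\<close> in \<open>X\<close> extends \<open>S\<close>, so the next
  element may be chosen freely from \<open>X\<close> by counting. A round costs at most
  \<open>3 * n\<^sup>2 * r\<close> candidates and there are at most \<open>n\<close> rounds, so
  \<open>large\<close> keeps \<open>X\<close> nonempty.\<close>

lemma greedy_subdividing:
  fixes w :: "'a set \<Rightarrow> 'a" and B :: "'a \<Rightarrow> 'a set"
  assumes "finite C"
    and fin: "\<And>c. finite (B c)" and card: "\<And>c. card (B c) \<le> r" and self: "\<And>c. c \<in> B c"
    and cover: "\<And>u v. u \<in> C \<Longrightarrow> v \<in> C \<Longrightarrow> u \<noteq> v \<Longrightarrow> u \<in> B (w {u, v}) \<and> w {u, v} \<noteq> u"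
    and large: "3 * n ^ 3 * r < card C"
    and "k \<le> n"
  shows "\<exists>S X. S \<union> X \<subseteq> C \<and> S \<inter> X = {} \<and> card S = k \<and>
           (\<forall>x\<in>X. subdividing w (insert x S)) \<and> card C \<le> card X + k * (3 * n\<^sup>2 * r)"
  using \<open>k \<le> n\<close>
proof (induction k)
  case 0
  have "\<forall>x\<in>C. subdividing w {x}"
    by (auto simp: subdividing_def pairs_def)
  then show ?case by (intro exI[of _ "{}"] exI[of _ C]) auto
next
  case (Suc k)
  then obtain S X where SX: "S \<union> X \<subseteq> C" "S \<inter> X = {}" "card S = k"
    "\<And>x. x \<in> X \<Longrightarrow> subdividing w (insert x S)" "card C \<le> card X + k * (3 * n\<^sup>2 * r)"
    by auto
  have finX: "finite X" and finS: "finite S"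
    using SX(1) \<open>finite C\<close> by (auto intro: finite_subset)
  have "k * (3 * n\<^sup>2 * r) \<le> n * (3 * n\<^sup>2 * r)" using Suc.prems by (intro mult_le_mono1) simp
  also have "\<dots> = 3 * n ^ 3 * r" by (simp add: power2_eq_square power3_eq_cube)
  finally have "k * (3 * n\<^sup>2 * r) < card C" using large by linarith
  then have "X \<noteq> {}" using SX(5) by (metis add_0 card.empty not_le)
  \<comment> \<open>A single \<open>a\<close> may conflict with many \<open>x\<close>. For fixed
    \<open>x\<close>, however, the conflicting \<open>a\<close> lie in at most \<open>k\<close> sets
    of size at most \<open>r\<close>, and averaging turns this into a bound for one suitable
    \<open>a\<close>.\<close>
  let ?R = "\<lambda>a x. a \<in> (\<Union>b\<in>S. B (w {x, b}))"
  have "card {a \<in> X. ?R a x} \<le> k * r" for x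
  proof -
    have "card {a \<in> X. ?R a x} \<le> card (\<Union>b\<in>S. B (w {x, b}))"
      using finS fin by (intro card_mono) auto
    also have "\<dots> \<le> k * r" using finS SX(3) card by (intro card_UN_le_mult) auto
    finally show ?thesis .
  qed
  then obtain a where a: "a \<in> X" "card {x \<in> X. ?R a x} \<le> k * r"
    using exists_small_fibre[OF finX \<open>X \<noteq> {}\<close>, of ?R "k * r"] by blast
  let ?T = "insert a S"
  \<comment> \<open>The vertices in use once \<open>a\<close> is added: the branch vertices and the
    subdividing vertices between them.\<close>
  let ?I = "?T \<union> w ` pairs ?T"
  have cT: "card ?T = Suc k" using a SX finS by (auto simp: card_insert_if)
  have finI: "finite ?I" using finS finite_pairs[of ?T] by simp
  have "card ?I \<le> card ?T + card (w ` pairs ?T)" by (rule card_Un_le)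
  also have "\<dots> \<le> Suc k + (Suc k)\<^sup>2"
    using cT card_pairs_le[of ?T] card_image_le[of "pairs ?T" w] finite_pairs[of ?T] finS by auto
  finally have cI: "card (\<Union>c\<in>?I. B c) \<le> (Suc k + (Suc k)\<^sup>2) * r"
    using finI card by (intro card_UN_le_mult)
  \<comment> \<open>\<open>D\<close> collects the candidates to drop. As \<open>a\<close> lies in
    \<open>B a\<close>, it is dropped too, which keeps the new \<open>S\<close> and \<open>X\<close>
    disjoint.\<close>
  define D where "D = {x \<in> X. ?R a x} \<union> (\<Union>c\<in>?I. B c)"
  have finD: "finite D"
    unfolding D_def using finX finI fin by (intro finite_UnI finite_UN_I) simp_all
  have "card D \<le> k * r + (Suc k + (Suc k)\<^sup>2) * r"
    unfolding D_def using a(2) cI card_Un_le order_trans add_mono by meson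
  also have "\<dots> = (k + Suc k + (Suc k)\<^sup>2) * r" by (simp add: algebra_simps)
  \<comment> \<open>As \<open>Suc k \<le> n\<close>, each of the three summands is at most
    \<open>n\<^sup>2\<close>; hence the constant 3.\<close>
  also have "\<dots> \<le> (3 * n\<^sup>2) * r"
  proof (rule mult_le_mono1)
    have "(Suc k)\<^sup>2 \<le> n\<^sup>2" using Suc.prems by (rule power_mono) simp
    moreover have "n \<le> n\<^sup>2" by (simp add: power2_eq_square)
    ultimately show "k + Suc k + (Suc k)\<^sup>2 \<le> 3 * n\<^sup>2" using Suc.prems by linarith
  qed
  finally have cD: "card D \<le> 3 * n\<^sup>2 * r" .
  have "card X \<le> card (X - D) + card D"
    by (metis add.commute diff_card_le_card_Diff finD le_diff_conv)
  then have "card C \<le> card (X - D) + Suc k * (3 * n\<^sup>2 * r)"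
    using SX(5) cD by simp
  moreover have "subdividing w (insert x ?T)" if "x \<in> X - D" for x
  proof (rule subdividing_insert_insert[of a x S B w])
    have xD: "x \<in> X" "x \<notin> D" using that by auto
    have "a \<in> D" unfolding D_def using self[of a] by auto
    then show "a \<noteq> x" using xD by auto
    show "a \<notin> S" "x \<notin> S" using a xD SX by auto
    show "subdividing w ?T" "subdividing w (insert x S)" using SX(4) a xD by auto
    show "a \<notin> B (w {x, b})" if "b \<in> S" for b using xD that unfolding D_def by auto
    show "x \<notin> B c" if "c \<in> ?T \<union> w ` pairs ?T" for c
      using xD that unfolding D_def by blast
    have sub: "insert x ?T \<subseteq> C" using xD a SX(1) by auto
    show "u \<in> B (w {u, v}) \<and> w {u, v} \<noteq> u"
      if "u \<in> insert x ?T" "v \<in> insert x ?T" "u \<noteq> v" for u v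
      using cover that sub by blast
  qed (rule self)
  moreover have "?T \<inter> (X - D) = {}"
    using SX(2) self[of a] unfolding D_def by auto
  moreover have "?T \<union> (X - D) \<subseteq> C" using SX(1) a by auto
  ultimately show ?case using cT by blast
qed

section \<open>Realising a subdivided complete graph as a subgraph\<close>

text \<open>The subdivision has vertices in a sum type, while a subgraph of a given graph must use
  the vertex type of that graph. An injective relabelling \<open>\<phi>\<close>, applied to both
  ends of each arc, bridges the two.\<close>

lemma pair_graph_image_one_subdivision:
  fixes K :: "'b pair_pre_digraph" and \<phi> :: "'b + 'b set \<Rightarrow> 'a"
  assumes K: "K\<^bsub>m\<^esub> (with_proj K)" and inj: "inj_on \<phi> (pverts (one_subdivision K))"
  defines "H \<equiv> \<lparr>pverts = \<phi> ` pverts (one_subdivision K),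
                 parcs = map_prod \<phi> \<phi> ` parcs (one_subdivision K)\<rparr>"
  shows "pair_graph H" "digraph_iso (with_proj (one_subdivision K)) (with_proj H)"
proof -
  let ?S = "one_subdivision K"
  from K have fin: "finite (pverts K)" and arcs: "parcs K = {(u, v). (u, v) \<in> pverts K \<times> pverts K \<and> u \<noteq> v}"
    by (auto simp: complete_digraph_pair_def)
  have wf: "fst e \<in> pverts ?S" "snd e \<in> pverts ?S" "fst e \<noteq> snd e" if "e \<in> parcs ?S" for e
  proof -
    from that obtain u v where uv: "(u, v) \<in> parcs K"
      and e: "e = (Inl u, Inr {u, v}) \<or> e = (Inr {u, v}, Inl u)"
      by (auto simp: one_subdivision_def)
    have "Inl u \<in> pverts ?S" using uv arcs by (simp add: one_subdivision_def)
    moreover have "Inr {u, v} \<in> pverts ?S" using uv unfolding one_subdivision_def by auto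
    ultimately show "fst e \<in> pverts ?S" "snd e \<in> pverts ?S" "fst e \<noteq> snd e" using e by auto
  qed
  have sym: "(y, x) \<in> parcs ?S" if "(x, y) \<in> parcs ?S" for x y
    using that unfolding one_subdivision_def by auto
  have "{Inr {u, v}::'b + 'b set | u v. (u, v) \<in> parcs K} \<subseteq> Inr ` Pow (pverts K)"
    using arcs by auto
  then have "finite {Inr {u, v}::'b + 'b set | u v. (u, v) \<in> parcs K}"
    by (rule finite_subset) (use fin in simp)
  then have fS: "finite (pverts ?S)" using fin by (simp add: one_subdivision_def)
  then have fA: "finite (parcs ?S)"
    using wf by (intro finite_subset[of "parcs ?S" "pverts ?S \<times> pverts ?S"]) auto
  show "pair_graph H"
  proof unfold_locales
    fix e assume "e \<in> parcs H"
    then show "fst e \<in> pverts H" "snd e \<in> pverts H" "fst e \<noteq> snd e"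
      using wf inj by (auto simp: H_def inj_on_eq_iff)
  next
    show "finite (pverts H)" "finite (parcs H)" using fS fA by (auto simp: H_def)
    show "symmetric (with_proj H)"
      unfolding symmetric_def by (rule symI) (auto simp: H_def dest: sym intro: rev_image_eqI)
  qed
  let ?h = "\<lparr>iso_verts = \<phi>, iso_arcs = map_prod \<phi> \<phi>, iso_head = snd, iso_tail = fst\<rparr>"
  have "inj_on (map_prod \<phi> \<phi>) (pverts ?S \<times> pverts ?S)"
    using inj by (intro map_prod_inj_on)
  then have "inj_on (map_prod \<phi> \<phi>) (parcs ?S)"
    by (rule inj_on_subset) (use wf in auto)
  then have "pre_digraph.digraph_isomorphism (with_proj ?S) ?h"
    unfolding pre_digraph.digraph_isomorphism_def
    using inj wf by (auto simp: wf_digraph_wp_iff pair_wf_digraph_def)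
  moreover have "with_proj H = app_iso ?h (with_proj ?S)"
    by (simp add: app_iso_def with_proj_def H_def)
  ultimately show "digraph_iso (with_proj ?S) (with_proj H)"
    unfolding digraph_iso_def by blast
qed

text \<open>An enumeration \<open>f\<close> of \<open>S\<close> places the branch vertices, since
  the complete graph has to live on \<open>nat\<close>, and \<open>w\<close> places the subdividing
  vertices. \<open>subdividing\<close> makes the combined map injective; \<open>adj\<close> and the
  symmetry of \<open>G\<close> provide the arcs.\<close>

lemma subdivision_of_subdividing:
  fixes G :: "'a pair_pre_digraph"
  assumes "pair_graph G" "G \<in> \<F>" "finite S" "S \<subseteq> pverts G" and sub: "subdividing w S"
    and adj: "\<And>u v. u \<in> S \<Longrightarrow> v \<in> S \<Longrightarrow> u \<noteq> v \<Longrightarrow> (w {u, v}, u) \<in> parcs G"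
  shows "\<exists>H\<in>subgraph_closure \<F>. is_one_subdivision_of_complete (card S) H"
proof -
  interpret pair_graph G by fact
  let ?m = "card S"
  obtain f where f: "bij_betw f {..<?m} S"
    using ex_bij_betw_nat_finite[OF \<open>finite S\<close>] by (auto simp: lessThan_atLeast0)
  then have finj: "inj_on f {..<?m}" and fS: "f ` {..<?m} = S" by (auto simp: bij_betw_def)
  define K :: "nat pair_pre_digraph" where
    "K = \<lparr>pverts = {..<?m}, parcs = {(u, v). (u, v) \<in> {..<?m} \<times> {..<?m} \<and> u \<noteq> v}\<rparr>"
  have K: "K\<^bsub>?m\<^esub> (with_proj K)" by (simp add: complete_digraph_pair_def K_def)
  define \<phi> where "\<phi> = case_sum f (\<lambda>e. w (f ` e))"
  have V: "pverts (one_subdivision K) = Inl ` {..<?m} \<union> Inr ` pairs {..<?m}"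
    by (auto simp: one_subdivision_def K_def pairs_def)
  have pf: "f ` e \<in> pairs S" if "e \<in> pairs {..<?m}" for e
  proof -
    from that obtain u v where "e = {u, v}" "u < ?m" "v < ?m" "u \<noteq> v" by (auto simp: pairs_def)
    moreover from this have "f u \<noteq> f v" using finj by (auto dest: inj_onD)
    moreover have "f u \<in> S" "f v \<in> S" using calculation fS by auto
    ultimately show ?thesis by (auto simp: pairs_def)
  qed
  have ein: "e \<subseteq> {..<?m}" if "e \<in> pairs {..<?m}" for e
    using that by (auto simp: pairs_def)
  have "inj_on \<phi> (pverts (one_subdivision K))"
  proof (rule inj_onI)
    have w: "inj_on w (pairs S)" "\<And>e. e \<in> pairs S \<Longrightarrow> w e \<notin> S"
      using sub unfolding subdividing_def by auto
    have wf: "e = e'" if "e \<in> pairs {..<?m}" "e' \<in> pairs {..<?m}" "w (f ` e) = w (f ` e')" for e e'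
      using inj_onD[OF w(1) that(3)] pf that ein finj by (auto simp: inj_on_image_eq_iff)
    have ne: "f i \<noteq> w (f ` e)" if "i < ?m" "e \<in> pairs {..<?m}" for i e
      using w(2)[OF pf[OF that(2)]] fS that(1) by (metis imageI lessThan_iff)
    fix x y
    assume "x \<in> pverts (one_subdivision K)" "y \<in> pverts (one_subdivision K)" "\<phi> x = \<phi> y"
    then show "x = y"
      unfolding V \<phi>_def
      by (elim UnE imageE) (use wf ne ne[symmetric] inj_onD[OF finj] in simp_all)
  qed
  note H = pair_graph_image_one_subdivision[OF K this]
  let ?H = "\<lparr>pverts = \<phi> ` pverts (one_subdivision K),
              parcs = map_prod \<phi> \<phi> ` parcs (one_subdivision K)\<rparr>"
  have arc: "(w (f ` {u, v}), f u) \<in> parcs G" if "u < ?m" "v < ?m" "u \<noteq> v" for u v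
    using adj[of "f u" "f v"] that fS finj by (auto dest: inj_onD)
  have "subgraph (with_proj ?H) (with_proj G)"
  proof (rule subgraphI)
    interpret H: pair_graph ?H by (rule H(1))
    have "parcs (one_subdivision K) = {(Inl u, Inr {u, v}) | u v. u < ?m \<and> v < ?m \<and> u \<noteq> v}
        \<union> {(Inr {u, v}, Inl u) | u v. u < ?m \<and> v < ?m \<and> u \<noteq> v}"
      by (auto simp: one_subdivision_def K_def)
    then show "arcs (with_proj ?H) \<subseteq> arcs (with_proj G)"
      using arc arcs_symmetric[OF arc] by (auto simp: \<phi>_def)
    have "w (f ` e) \<in> pverts G" if "e \<in> pairs {..<?m}" for e
      using that in_arcsD1[OF arc] unfolding pairs_def by fastforce
    then show "verts (with_proj ?H) \<subseteq> verts (with_proj G)"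
      using fS \<open>S \<subseteq> pverts G\<close> by (auto simp: V \<phi>_def)
    show "wf_digraph (with_proj ?H)" "wf_digraph (with_proj G)"
      by unfold_locales
  qed (rule compatibleI_with_proj)
  then have "?H \<in> subgraph_closure \<F>"
    unfolding subgraph_closure_def using H(1) \<open>G \<in> \<F>\<close> by blast
  moreover have "is_one_subdivision_of_complete ?m ?H"
    unfolding is_one_subdivision_of_complete_def using K H(2) by blast
  ultimately show ?thesis by blast
qed

section \<open>Basic bounds for \<open>omega\<close> and \<open>rho\<close>\<close>

lemma finite_clique_cards:
  assumes "pair_graph G"
  shows "finite {card C | C. sigma_clique G \<Sigma> C}"
proof -
  interpret pair_graph G by fact
  have "{card C | C. sigma_clique G \<Sigma> C} \<subseteq> card ` Pow (pverts G)"
    by (auto simp: sigma_clique_def)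
  then show ?thesis using pair_finite_verts by (meson finite_Pow_iff finite_imageI finite_subset)
qed

lemma card_le_omega: "pair_graph G \<Longrightarrow> sigma_clique G \<Sigma> C \<Longrightarrow> card C \<le> omega G \<Sigma>"
  unfolding omega_def by (rule Max_ge[OF finite_clique_cards]) auto

lemma omega_clique:
  assumes "pair_graph G"
  obtains C where "sigma_clique G \<Sigma> C" "card C = omega G \<Sigma>"
proof -
  \<comment> \<open>The empty set is a clique, so the maximum is attained even if \<open>G\<close>
    has no vertices.\<close>
  have "{card C | C. sigma_clique G \<Sigma> C} \<noteq> {}"
    by (auto simp: sigma_clique_def intro!: exI[of _ "{}"])
  then have "omega G \<Sigma> \<in> {card C | C. sigma_clique G \<Sigma> C}"
    unfolding omega_def by (rule Max_in[OF finite_clique_cards[OF assms]])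
  then show thesis using that by auto
qed

lemma card_le_rho:
  assumes "pair_graph G" "v \<in> pverts G"
  shows "card (\<Sigma> v) \<le> rho G \<Sigma>"
proof -
  interpret pair_graph G by fact
  show ?thesis unfolding rho_def
    using assms pair_finite_verts by (intro cSUP_upper) (auto intro: bdd_above_finite)
qed

lemma neighbors_eq: "neighbors G v = {u. (v, u) \<in> parcs G}"
  by (simp add: neighbors_def)

lemma neighborhood_system_finite:
  assumes "pair_graph G" "neighborhood_system G \<Sigma>" "v \<in> pverts G"
  shows "finite (\<Sigma> v)"
proof -
  interpret pair_graph G by fact
  have "\<Sigma> v \<subseteq> pverts G"
    using assms in_arcsD2 by (auto simp: neighborhood_system_def neighbors_eq)
  then show ?thesis using pair_finite_verts by (rule finite_subset)
qed

text \<open>With all sets empty, no pair of distinct vertices is covered. As (ii) is silent at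
  \<open>rho = 0\<close>, this supplies the value there when (ii) is turned into a bounding
  function.\<close>

lemma omega_le_1:
  assumes G: "pair_graph G" and \<Sigma>: "neighborhood_system G \<Sigma>" and "rho G \<Sigma> = 0"
  shows "omega G \<Sigma> \<le> 1"
proof -
  obtain C where C: "sigma_clique G \<Sigma> C" "card C = omega G \<Sigma>"
    using G by (rule omega_clique)
  \<comment> \<open>Cardinality 0 means empty only for finite sets, hence the appeal to
    \<open>neighborhood_system_finite\<close>.\<close>
  have "\<Sigma> w = {}" if "w \<in> pverts G" for w
    using card_le_rho[OF G that, of \<Sigma>] neighborhood_system_finite[OF G \<Sigma> that] assms(3) by simp
  then have "\<forall>u\<in>C. \<forall>v\<in>C. u = v"
    using C(1) unfolding sigma_clique_def by blast
  then have "card C \<le> 1"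
    by (metis One_nat_def card_le_Suc0_iff_eq card.infinite zero_le)
  then show ?thesis using C by simp
qed

section \<open>From a large clique to a subdivision\<close>

text \<open>A clique beyond the bound would let the greedy construction reach \<open>n\<close>
  branch vertices, giving a forbidden subdivision. The factor is \<open>Suc (rho G \<Sigma>)\<close>
  because a closed set may have one vertex more than the set of \<open>\<Sigma>\<close> it comes
  from.\<close>

lemma omega_bound:
  assumes G: "pair_graph G" "G \<in> \<F>" and \<Sigma>: "neighborhood_system G \<Sigma>"
    and no: "\<not> (\<exists>H\<in>subgraph_closure \<F>. is_one_subdivision_of_complete n H)"
  shows "omega G \<Sigma> \<le> 3 * n ^ 3 * Suc (rho G \<Sigma>)"
proof (rule ccontr)
  assume "\<not> ?thesis"
  then have large: "3 * n ^ 3 * Suc (rho G \<Sigma>) < omega G \<Sigma>" by simp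
  interpret pair_graph G by fact
  obtain C where C: "sigma_clique G \<Sigma> C" "card C = omega G \<Sigma>"
    using G(1) by (rule omega_clique)
  have CV: "C \<subseteq> pverts G" using C by (simp add: sigma_clique_def)
  \<comment> \<open>The choice depends on the set \<open>e\<close> alone, so both orders of a pair
    get the same vertex.\<close>
  define w where "w e = (SOME z. z \<in> pverts G \<and> e \<subseteq> \<Sigma> z)" for e
  \<comment> \<open>Outside the graph \<open>\<Sigma>\<close> is arbitrary; the default
    \<open>{c}\<close> makes finiteness and the size bound valid for every \<open>c\<close>, as
    \<open>greedy_subdividing\<close> demands.\<close>
  define B where "B c = insert c (if c \<in> pverts G then \<Sigma> c else {})" for c
  have w: "w {u, v} \<in> pverts G \<and> {u, v} \<subseteq> \<Sigma> (w {u, v})" if "u \<in> C" "v \<in> C" "u \<noteq> v" for u v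
    unfolding w_def
    by (rule someI_ex) (use that C(1) in \<open>unfold sigma_clique_def, blast\<close>)
  have adj: "(w {u, v}, u) \<in> parcs G" if "u \<in> C" "v \<in> C" "u \<noteq> v" for u v
    using w[OF that] \<Sigma> by (auto simp: neighborhood_system_def neighbors_eq)
  have "finite (B c)" "card (B c) \<le> Suc (rho G \<Sigma>)" for c
    unfolding B_def
    using neighborhood_system_finite[OF G(1) \<Sigma>, of c] card_le_rho[OF G(1), of c \<Sigma>]
    by (auto simp: card_insert_if)
  moreover have "u \<in> B (w {u, v}) \<and> w {u, v} \<noteq> u" if "u \<in> C" "v \<in> C" "u \<noteq> v" for u v
    using w[OF that] no_loops'[OF adj[OF that]] by (auto simp: B_def)
  moreover have "c \<in> B c" for c by (simp add: B_def)
  moreover have "finite C" using CV pair_finite_verts by (rule finite_subset)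
  ultimately obtain S X where SX: "S \<union> X \<subseteq> C" "card S = n"
    "\<And>x. x \<in> X \<Longrightarrow> subdividing w (insert x S)" "card C \<le> card X + n * (3 * n\<^sup>2 * Suc (rho G \<Sigma>))"
    using greedy_subdividing[of C B "Suc (rho G \<Sigma>)" w n n] large C(2) by auto
  have "n * (3 * n\<^sup>2 * Suc (rho G \<Sigma>)) = 3 * n ^ 3 * Suc (rho G \<Sigma>)"
    by (simp add: power2_eq_square power3_eq_cube algebra_simps)
  \<comment> \<open>The invariant speaks only about \<open>insert x S\<close>, so a surviving
    candidate is used to conclude about \<open>S\<close> itself.\<close>
  then obtain x where "x \<in> X" using SX(4) large C(2) by fastforce
  then have "subdividing w S" using SX(3) by (auto intro: subdividing_mono)
  moreover have "finite S" using SX(1) \<open>finite C\<close> by (auto intro: finite_subset)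
  moreover have "(w {u, v}, u) \<in> parcs G" if "u \<in> S" "v \<in> S" "u \<noteq> v" for u v
    using adj that SX(1) by blast
  ultimately show False
    using subdivision_of_subdividing[of G \<F> S w] G CV SX(1,2) no by blast
qed

section \<open>From a subdivision to a large clique\<close>

text \<open>Each subdividing vertex receives its two branch neighbors and every other vertex the
  empty set, so the \<open>m\<close> branch vertices form a clique. \<open>2 \<le> m\<close>
  guarantees an edge, so that \<open>rho\<close> is 2 and not 0.\<close>

lemma exists_system_of_subdivision:
  fixes G :: "'a pair_pre_digraph"
  assumes G: "pair_graph G" and sub: "subgraph (with_proj H) (with_proj G)"
    and H: "is_one_subdivision_of_complete m H" and "2 \<le> m"
  shows "\<exists>\<Sigma>. neighborhood_system G \<Sigma> \<and> rho G \<Sigma> = 2 \<and> m \<le> omega G \<Sigma>"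
proof -
  interpret pair_graph G by fact
  obtain K :: "nat pair_pre_digraph" and h where K: "K\<^bsub>m\<^esub> (with_proj K)"
    and iso: "pre_digraph.digraph_isomorphism (with_proj (one_subdivision K)) h"
    and eq: "with_proj H = app_iso h (with_proj (one_subdivision K))"
    using H unfolding is_one_subdivision_of_complete_def digraph_iso_def by blast
  let ?S = "one_subdivision K" and ?f = "iso_verts h"
  from K have fin: "finite (pverts K)" "card (pverts K) = m"
    and arcs: "parcs K = {(u, v). (u, v) \<in> pverts K \<times> pverts K \<and> u \<noteq> v}"
    by (auto simp: complete_digraph_pair_def)
  have inj: "inj_on ?f (pverts ?S)"
    using iso by (simp add: pre_digraph.digraph_isomorphism_def)
  have HV: "pverts H = ?f ` pverts ?S" and HA: "parcs H = iso_arcs h ` parcs ?S"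
    using arg_cong[OF eq, of verts] arg_cong[OF eq, of arcs] by simp_all
  \<comment> \<open>An isomorphism carries its own map on arcs. Since both graphs in
    \<open>eq\<close> have the projections as tail and head, this map must apply \<open>?f\<close>
    to both ends of an arc.\<close>
  have ht: "iso_tail h = fst" "iso_head h = snd"
    using arg_cong[OF eq, of tail] arg_cong[OF eq, of head] by simp_all
  have arcG: "(?f x, ?f y) \<in> parcs G" if "(x, y) \<in> parcs ?S" for x y
  proof -
    have "iso_arcs h (x, y) = (?f x, ?f y)"
      using iso that ht by (auto simp: pre_digraph.digraph_isomorphism_def prod_eq_iff)
    then have "(?f x, ?f y) \<in> parcs H" using HA that by (metis image_eqI)
    then show ?thesis using sub by (auto simp: subgraph_def)
  qed
  have vG: "?f x \<in> pverts G" if "x \<in> pverts ?S" for x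
    using sub HV that by (auto simp: subgraph_def)
  have inl: "Inl u \<in> pverts ?S" if "u \<in> pverts K" for u
    using that by (simp add: one_subdivision_def)
  have inr: "Inr {u, v} \<in> pverts ?S" if "(u, v) \<in> parcs K" for u v
    using that by (auto simp: one_subdivision_def)
  \<comment> \<open>Only one end of each arc is listed; the opposite arc has the same subdividing
    vertex and contributes the other end.\<close>
  define \<Sigma> where "\<Sigma> z = {?f (Inl u) | u v. (u, v) \<in> parcs K \<and> z = ?f (Inr {u, v})}" for z
  have \<Sigma>_eq: "\<Sigma> (?f (Inr {u, v})) = {?f (Inl u), ?f (Inl v)}" if uv: "(u, v) \<in> parcs K" for u v
  proof -
    have "{u', v'} = {u, v}" if "(u', v') \<in> parcs K" "?f (Inr {u, v}) = ?f (Inr {u', v'})" for u' v'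
      using inj_onD[OF inj that(2) inr[OF uv] inr[OF that(1)]] by simp
    moreover have "(v, u) \<in> parcs K" using uv arcs by auto
    ultimately show ?thesis
      unfolding \<Sigma>_def using uv by (fastforce simp: doubleton_eq_iff insert_commute)
  qed
  have card2: "card (\<Sigma> (?f (Inr {u, v}))) = 2" if uv: "(u, v) \<in> parcs K" for u v
  proof -
    have "?f (Inl u) \<noteq> ?f (Inl v)"
      using uv arcs inl inj_onD[OF inj, of "Inl u" "Inl v"] by auto
    then show ?thesis using \<Sigma>_eq[OF uv] by simp
  qed
  have ns: "neighborhood_system G \<Sigma>"
  proof -
    have "(?f (Inr {u, v}), ?f (Inl u)) \<in> parcs G" if "(u, v) \<in> parcs K" for u v
      using that by (intro arcG) (auto simp: one_subdivision_def)
    then show ?thesis by (auto simp: neighborhood_system_def neighbors_eq \<Sigma>_def)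
  qed
  have le2: "card (\<Sigma> z) \<le> 2" for z
  proof (cases "\<Sigma> z = {}")
    case False
    then obtain u v where "(u, v) \<in> parcs K" "z = ?f (Inr {u, v})" by (auto simp: \<Sigma>_def)
    then show ?thesis using card2 by simp
  qed simp
  obtain a b where ab: "(a, b) \<in> parcs K"
  proof -
    obtain a b where "a \<in> pverts K" "b \<in> pverts K" "a \<noteq> b"
      using fin \<open>2 \<le> m\<close> by (metis card_le_Suc0_iff_eq not_less_eq_eq numeral_2_eq_2)
    then show thesis using that arcs by auto
  qed
  have "rho G \<Sigma> = 2"
  proof (rule antisym)
    show "rho G \<Sigma> \<le> 2"
      unfolding rho_def using vG[OF inr[OF ab]] le2 by (intro cSUP_least) auto
    show "2 \<le> rho G \<Sigma>"
      using card_le_rho[OF G vG[OF inr[OF ab]], of \<Sigma>] card2[OF ab] by simp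
  qed
  moreover have "m \<le> omega G \<Sigma>"
  proof -
    let ?C = "?f ` Inl ` pverts K"
    have "\<exists>z\<in>pverts G. ?f (Inl u) \<in> \<Sigma> z \<and> ?f (Inl v) \<in> \<Sigma> z"
      if "u \<in> pverts K" "v \<in> pverts K" "?f (Inl u) \<noteq> ?f (Inl v)" for u v
    proof -
      have "(u, v) \<in> parcs K" using that arcs by auto
      then show ?thesis using \<Sigma>_eq vG inr by blast
    qed
    then have "sigma_clique G \<Sigma> ?C"
      using vG inl by (auto simp: sigma_clique_def)
    moreover have "card ?C = m"
    proof -
      have "inj_on ?f (Inl ` pverts K)" using inj by (rule inj_on_subset) (use inl in auto)
      then show ?thesis using fin by (simp add: card_image)
    qed
    ultimately show ?thesis using card_le_omega[OF G] by metis
  qed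
  ultimately show ?thesis using ns by blast
qed

section \<open>Equivalence of the four conditions\<close>

theorem theorem11:
  fixes \<F> :: "'a pair_pre_digraph set"
  assumes "\<And>G. G \<in> \<F> \<Longrightarrow> pair_graph G"
  defines "i \<equiv>
      Sup {enat (omega G \<Sigma>) | G \<Sigma>. G \<in> \<F> \<and> neighborhood_system G \<Sigma> \<and> rho G \<Sigma> = 2} < \<infinity>"
    and "ii \<equiv> \<exists>C :: real. \<forall>G\<in>\<F>. \<forall>\<Sigma>. neighborhood_system G \<Sigma> \<and> rho G \<Sigma> > 0 \<longrightarrow>
      real (omega G \<Sigma>) \<le> C * real (rho G \<Sigma>)"
    and "iii \<equiv> \<exists>f :: nat \<Rightarrow> real. \<forall>G\<in>\<F>. \<forall>\<Sigma>. neighborhood_system G \<Sigma> \<longrightarrow>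
      real (omega G \<Sigma>) \<le> f (rho G \<Sigma>)"
    and "iv \<equiv> \<exists>n. \<forall>m\<ge>n. \<not> (\<exists>H\<in>subgraph_closure \<F>. is_one_subdivision_of_complete m H)"
  shows "(i \<longleftrightarrow> ii) \<and> (ii \<longleftrightarrow> iii) \<and> (iii \<longleftrightarrow> iv)"
proof -
  have "ii" if iv
  proof -
    from \<open>iv\<close> obtain n where
      n: "\<not> (\<exists>H\<in>subgraph_closure \<F>. is_one_subdivision_of_complete n H)"
      unfolding iv_def by blast
    have "real (omega G \<Sigma>) \<le> real (6 * n ^ 3) * real (rho G \<Sigma>)"
      if "G \<in> \<F>" "neighborhood_system G \<Sigma>" "rho G \<Sigma> > 0" for G \<Sigma>
    proof -
      have "omega G \<Sigma> \<le> 3 * n ^ 3 * Suc (rho G \<Sigma>)"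
        using omega_bound[OF _ _ _ n] assms(1) that by blast
      \<comment> \<open>\<open>Suc r \<le> 2 * r\<close> for positive \<open>r\<close>, which
        doubles the constant.\<close>
      also have "\<dots> \<le> 3 * n ^ 3 * (2 * rho G \<Sigma>)"
        using that(3) by (intro mult_le_mono2) simp
      finally have "omega G \<Sigma> \<le> 6 * n ^ 3 * rho G \<Sigma>" by simp
      then show ?thesis by (metis of_nat_le_iff of_nat_mult)
    qed
    then show "ii" unfolding ii_def by blast
  qed
  moreover have "iii" if ii
  proof -
    from \<open>ii\<close> obtain C :: real where C: "\<And>G \<Sigma>. G \<in> \<F> \<Longrightarrow> neighborhood_system G \<Sigma> \<Longrightarrow>
        rho G \<Sigma> > 0 \<Longrightarrow> real (omega G \<Sigma>) \<le> C * real (rho G \<Sigma>)"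
      unfolding ii_def by blast
    have "real (omega G \<Sigma>) \<le> (if rho G \<Sigma> = 0 then 1 else C * real (rho G \<Sigma>))"
      if "G \<in> \<F>" "neighborhood_system G \<Sigma>" for G \<Sigma>
      using C[OF that] omega_le_1[OF assms(1) that(2)] that(1) by auto
    then show "iii" unfolding iii_def
      by (intro exI[of _ "\<lambda>r. if r = 0 then 1 else C * real r"]) blast
  qed
  moreover have "i" if iii
  proof -
    from \<open>iii\<close> obtain f :: "nat \<Rightarrow> real" where f: "\<And>G \<Sigma>. G \<in> \<F> \<Longrightarrow> neighborhood_system G \<Sigma> \<Longrightarrow>
        real (omega G \<Sigma>) \<le> f (rho G \<Sigma>)"
      unfolding iii_def by blast
    \<comment> \<open>\<open>omega\<close> is integral, so the real bound \<open>f 2\<close> may be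
      rounded down.\<close>
    have "Sup {enat (omega G \<Sigma>) | G \<Sigma>. G \<in> \<F> \<and> neighborhood_system G \<Sigma> \<and> rho G \<Sigma> = 2}
        \<le> enat (nat \<lfloor>f 2\<rfloor>)"
    proof (rule Sup_least)
      fix x assume "x \<in> {enat (omega G \<Sigma>) | G \<Sigma>. G \<in> \<F> \<and> neighborhood_system G \<Sigma> \<and> rho G \<Sigma> = 2}"
      then obtain G \<Sigma> where G: "x = enat (omega G \<Sigma>)" "G \<in> \<F>"
        "neighborhood_system G \<Sigma>" "rho G \<Sigma> = 2"
        by blast
      have "real (omega G \<Sigma>) \<le> f 2" using f[OF G(2,3)] G(4) by simp
      then show "x \<le> enat (nat \<lfloor>f 2\<rfloor>)" using G(1) by (simp add: le_nat_floor)
    qed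
    then show "i" unfolding i_def using enat_ord_simps(4) le_less_trans by blast
  qed
  moreover have "iv" if i
  proof -
    let ?A = "{enat (omega G \<Sigma>) | G \<Sigma>. G \<in> \<F> \<and> neighborhood_system G \<Sigma> \<and> rho G \<Sigma> = 2}"
    from \<open>i\<close> obtain b where b: "Sup ?A = enat b" unfolding i_def by auto
    have le: "omega G \<Sigma> \<le> b" if "G \<in> \<F>" "neighborhood_system G \<Sigma>" "rho G \<Sigma> = 2" for G \<Sigma>
    proof -
      have "enat (omega G \<Sigma>) \<le> Sup ?A" using that by (intro Sup_upper) blast
      then show ?thesis using b by simp
    qed
    \<comment> \<open>The offset 2 serves twice: \<open>2 \<le> m\<close> gives a system with
      \<open>rho\<close> equal to 2, and \<open>b < m\<close> contradicts the supremum.\<close>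
    have False
      if m: "b + 2 \<le> m" and "H \<in> subgraph_closure \<F>" and H: "is_one_subdivision_of_complete m H"
      for m H
    proof -
      obtain G where G: "G \<in> \<F>" "subgraph (with_proj H) (with_proj G)"
        using \<open>H \<in> subgraph_closure \<F>\<close> unfolding subgraph_closure_def by blast
      then obtain \<Sigma> where "neighborhood_system G \<Sigma>" "rho G \<Sigma> = 2" "m \<le> omega G \<Sigma>"
        using exists_system_of_subdivision[OF assms(1) G(2) H] m G(1) by auto
      then show False using le[OF G(1), of \<Sigma>] m by simp
    qed
    then show "iv" unfolding iv_def by (intro exI[of _ "b + 2"]) blast
  qed
  ultimately show ?thesis by blast
qed

end
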